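(* Let $T\in\mathbb{C}^{m\times n}$ be a partial isometry and let $A\in\mathbb{C}^{m\times n}$. Then $A$ is $T$-EP if and only if $TA^\dagger A=AA^\dagger T$ and $A=AT^*T$.
   Context: $\mathcal{R}(\cdot)$ denotes the range space, $^*$ the conjugate transpose, and $A^\dagger$ the Moore-Penrose inverse of $A$. $T$ is a partial isometry if $T=TT^*T$. $A$ is $T$-EP if $\mathcal{R}(A)=\mathcal{R}(TA^*T)$ and $A=AT^*T$. *)

theory Defs
  imports "HOL-Analysis.Analysis"
begin

text \<open>
  An \<open>m \<times> n\<close> complex matrix has type \<open>complex^'n^'m\<close>: the row index type comes last.
\<close>

definition conj_transpose :: "complex^'n^'m \<Rightarrow> complex^'m^'n" where
  "conj_transpose A = map_matrix cnj (transpose A)"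

definition range_space :: "complex^'n^'m \<Rightarrow> (complex^'m) set" where
  "range_space A = range ((*v) A)"

definition is_moore_penrose_inverse :: "complex^'n^'m \<Rightarrow> complex^'m^'n \<Rightarrow> bool" where
  "is_moore_penrose_inverse A X \<longleftrightarrow>
     A ** X ** A = A \<and>
     X ** A ** X = X \<and>
     conj_transpose (A ** X) = A ** X \<and>
     conj_transpose (X ** A) = X ** A"

definition moore_penrose_inverse :: "complex^'n^'m \<Rightarrow> complex^'m^'n" where
  "moore_penrose_inverse A = (THE X. is_moore_penrose_inverse A X)"

definition partial_isometry :: "complex^'n^'m \<Rightarrow> bool" where
  "partial_isometry T \<longleftrightarrow> T = T ** conj_transpose T ** T"

definition T_EP :: "complex^'n^'m \<Rightarrow> complex^'n^'m \<Rightarrow> bool" where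
  "T_EP T A \<longleftrightarrow>
     range_space A = range_space (T ** conj_transpose A ** T) \<and>
     A = A ** conj_transpose T ** T"

text \<open>
  The definite description is justified: every matrix has exactly one Moore--Penrose inverse.
\<close>

lemma conj_transpose_nth [simp]: "conj_transpose A $ i $ j = cnj (A $ j $ i)"
  by (simp add: conj_transpose_def transpose_def)

lemma conj_transpose_involution [simp]: "conj_transpose (conj_transpose A) = A"
  by (simp add: vec_eq_iff)

lemma conj_transpose_mult: "conj_transpose (A ** B) = conj_transpose B ** conj_transpose A"
  by (simp add: vec_eq_iff matrix_matrix_mult_def mult.commute)

lemma inner_conj_transpose: "(A *v x) \<bullet> y = x \<bullet> (conj_transpose A *v y)"
proof -
  have ii: "inner a b = Re (a * cnj b)" for a b :: complex
    by (simp add: inner_complex_def)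
  have "(A *v x) \<bullet> y = Re (\<Sum>i\<in>UNIV. \<Sum>j\<in>UNIV. A $ i $ j * x $ j * cnj (y $ i))"
    by (simp add: inner_vec_def ii matrix_vector_mult_def sum_distrib_right)
  also have "\<dots> = Re (\<Sum>j\<in>UNIV. \<Sum>i\<in>UNIV. A $ i $ j * x $ j * cnj (y $ i))"
    by (subst sum.swap) simp
  also have "\<dots> = x \<bullet> (conj_transpose A *v y)"
    by (simp add: inner_vec_def ii matrix_vector_mult_def sum_distrib_left mult_ac
        del: times_complex.sel)
  finally show ?thesis .
qed

lemma normal_equation_solvable:
  "\<exists>x. conj_transpose A *v (A *v x) = conj_transpose A *v y"
proof -
  have sub: "span (range ((*v) A)) = range ((*v) A)"
    by (intro span_eq_iff[THEN iffD2] linear_subspace_image linearI)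
       (auto simp: vec_eq_iff matrix_vector_mult_def scaleR_sum_right
         sum.distrib distrib_left)
  obtain a b where a: "a \<in> span (range ((*v) A))"
    and b: "\<And>w. w \<in> span (range ((*v) A)) \<Longrightarrow> orthogonal b w" and y: "y = a + b"
    using orthogonal_subspace_decomp_exists[of "range ((*v) A)" y] by metis
  obtain x where x: "a = A *v x" using a sub by auto
  have "(A *v (conj_transpose A *v b)) \<bullet> b = 0"
    using b[of "A *v (conj_transpose A *v b)"] sub by (auto simp: orthogonal_def inner_commute)
  then have "conj_transpose A *v b = 0"
    by (simp add: inner_conj_transpose[of A])
  then show ?thesis
    using x y by (auto simp: matrix_vector_right_distrib)
qed

lemma matrix_vector_mult_axis: "M *v axis j 1 = column j M"
  for M :: "complex^'n^'m"
  by (simp add: matrix_vector_mult_def column_def axis_def vec_eq_iff if_distrib cong: if_cong)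

lemma ex_inverse_13: "\<exists>X. A ** X ** A = A \<and> conj_transpose (A ** X) = A ** X"
proof -
  obtain g where g: "\<And>y. conj_transpose A *v (A *v g y) = conj_transpose A *v y"
    using normal_equation_solvable[of A] by metis
  define X where "X = (\<chi> i j. g (axis j 1) $ i)"
  have "column j (conj_transpose A ** (A ** X)) = column j (conj_transpose A)" for j
  proof -
    have X: "X *v axis j 1 = g (axis j 1)"
      by (simp add: X_def matrix_vector_mult_axis column_def vec_eq_iff)
    have "(conj_transpose A ** (A ** X)) *v axis j 1 = conj_transpose A *v axis j 1"
      using g[of "axis j 1"] X by (simp flip: matrix_vector_mul_assoc)
    then show ?thesis
      by (simp add: matrix_vector_mult_axis)
  qed
  then have n: "conj_transpose A ** (A ** X) = conj_transpose A"
    by (simp add: column_def vec_eq_iff)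
  have "conj_transpose (A ** X) ** (A ** X) = conj_transpose (A ** X)"
    using n by (simp add: conj_transpose_mult flip: matrix_mul_assoc)
  then have h: "conj_transpose (A ** X) = A ** X"
    by (metis conj_transpose_mult conj_transpose_involution)
  have "conj_transpose (conj_transpose A ** (A ** X)) = A"
    using n by simp
  then have "A ** X ** A = A"
    using h by (simp add: conj_transpose_mult[of "conj_transpose A"])
  with h show ?thesis by blast
qed

lemma moore_penrose_inverse_exists: "\<exists>X. is_moore_penrose_inverse A X"
proof -
  obtain X where X: "A ** X ** A = A" "conj_transpose (A ** X) = A ** X"
    using ex_inverse_13[of A] by blast
  obtain Z where Z: "conj_transpose A ** Z ** conj_transpose A = conj_transpose A"
    "conj_transpose (conj_transpose A ** Z) = conj_transpose A ** Z"
    using ex_inverse_13[of "conj_transpose A"] by blast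
  define Y where "Y = conj_transpose Z"
  have Y: "A ** Y ** A = A" "conj_transpose (Y ** A) = Y ** A"
    using arg_cong[OF Z(1), of conj_transpose] Z(2)
    by (simp_all add: Y_def conj_transpose_mult matrix_mul_assoc)
  have "A ** (Y ** A ** X) = A ** X" "(Y ** A ** X) ** A = Y ** A"
    using X(1) Y(1) by (metis matrix_mul_assoc)+
  moreover from this have "(Y ** A ** X) ** A ** (Y ** A ** X) = Y ** A ** X"
    using Y(1) by (metis matrix_mul_assoc)
  ultimately have "is_moore_penrose_inverse A (Y ** A ** X)"
    using X Y by (simp add: is_moore_penrose_inverse_def)
  then show ?thesis by blast
qed

lemma moore_penrose_inverse_unique:
  assumes "is_moore_penrose_inverse A X" "is_moore_penrose_inverse A Y"
  shows "X = Y"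
proof -
  note x = assms(1)[unfolded is_moore_penrose_inverse_def]
  note y = assms(2)[unfolded is_moore_penrose_inverse_def]
  have "A ** X = conj_transpose (A ** Y ** (A ** X))"
    using x y by (metis matrix_mul_assoc)
  also have "\<dots> = A ** X ** (A ** Y)"
    using x y by (simp add: conj_transpose_mult[of "A ** Y"])
  also have "\<dots> = A ** Y"
    using x by (metis matrix_mul_assoc)
  finally have 1: "A ** X = A ** Y" .
  have "X ** A = conj_transpose (X ** A ** (Y ** A))"
    using x y by (metis matrix_mul_assoc)
  also have "\<dots> = Y ** A ** (X ** A)"
    using x y by (simp add: conj_transpose_mult[of "X ** A"])
  also have "\<dots> = Y ** A"
    using x by (metis matrix_mul_assoc)
  finally have 2: "X ** A = Y ** A" .
  show ?thesis
    using 1 2 x y by (metis matrix_mul_assoc)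
qed

lemma moore_penrose_inverse: "is_moore_penrose_inverse A (moore_penrose_inverse A)"
  unfolding moore_penrose_inverse_def
  by (metis theI moore_penrose_inverse_exists moore_penrose_inverse_unique)

end

theory Submission
  imports Defs
begin

text \<open>
  Write \<open>P = A A\<^sup>\<dagger>\<close> and \<open>Q = A\<^sup>\<dagger> A\<close> for the orthogonal projections onto the ranges of \<open>A\<close> and
  \<open>A\<^sup>*\<close>. The condition \<open>A = A T\<^sup>* T\<close> says that \<open>T\<close> is isometric on the range of \<open>Q\<close>, so
  \<open>G = T Q T\<^sup>*\<close> is the orthogonal projection onto the image of that range under \<open>T\<close>. Moreover
  \<open>G\<close> and \<open>P\<close> have the same trace, since \<open>tr G = tr (Q T\<^sup>* T) = tr Q = tr P\<close>. Two nested
  orthogonal projections with the same trace are equal (\<open>projection_eq_if_trace_eq\<close>), so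
  \<open>P = G\<close> already follows from \<open>P G = G\<close> (\<open>moore_penrose_projection_transport\<close>).

  Both sides of the equivalence turn out to be equivalent to \<open>P = T Q T\<^sup>*\<close>, once \<open>A = A T\<^sup>* T\<close> is
  assumed. If \<open>P = T Q T\<^sup>*\<close>, then multiplying by \<open>T\<close> gives \<open>P T = T Q\<close>. Conversely, \<open>P T = T Q\<close>
  gives \<open>P G = G\<close> by multiplying with \<open>T\<^sup>*\<close>. As for the ranges, \<open>P = T Q T\<^sup>*\<close> lets \<open>T\<close> carry the
  range of \<open>A\<^sup>*\<close> onto that of \<open>A\<close>, and it puts the range of \<open>A\<close> inside that of \<open>T\<close>, so that
  \<open>A\<^sup>*\<close> and \<open>A\<^sup>* T\<close> have the same range. In the other direction,
  equality of the ranges of \<open>A\<close> and \<open>T A\<^sup>* T\<close> puts the range of \<open>A\<close> inside that of \<open>T\<close> and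
  makes \<open>P\<close> fix \<open>T A\<^sup>* T\<close>, hence also \<open>T A\<^sup>*\<close> and \<open>G\<close>.
\<close>

text \<open>The factors may be rectangular, so the two traces belong to matrices of different sizes.\<close>

lemma trace_mult_commute:
  fixes A :: "'a::comm_semiring_1^'n^'m" and B :: "'a^'m^'n"
  shows "trace (A ** B) = trace (B ** A)"
  unfolding trace_def matrix_matrix_mult_def
  by (simp add: mult.commute) (rule sum.swap)

text \<open>The trace of \<open>M\<^sup>* M\<close> is the squared Frobenius norm of \<open>M\<close>.\<close>

lemma trace_conj_transpose_mult_eq_0:
  fixes M :: "complex^'n^'m"
  assumes "trace (conj_transpose M ** M) = 0"
  shows "M = 0"
proof -
  have "trace (conj_transpose M ** M) = of_real (\<Sum>j\<in>UNIV. \<Sum>i\<in>UNIV. (cmod (M $ i $ j))\<^sup>2)"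
    by (simp add: trace_def matrix_matrix_mult_def complex_norm_square mult.commute
        del: of_real_power)
  then have "(\<Sum>j\<in>UNIV. \<Sum>i\<in>UNIV. (cmod (M $ i $ j))\<^sup>2) = 0"
    using assms by (metis of_real_eq_0_iff)
  then show ?thesis
    by (simp add: vec_eq_iff sum_nonneg_eq_0_iff sum_nonneg)
qed

text \<open>
  The difference of nested orthogonal projections is again an orthogonal projection, so its trace
  is its squared Frobenius norm.
\<close>

lemma projection_eq_if_trace_eq:
  fixes P G :: "complex^'m^'m"
  assumes P: "P ** P = P" "conj_transpose P = P"
    and G: "G ** G = G" "conj_transpose G = G"
    and nested: "P ** G = G"
    and tr: "trace P = trace G"
  shows "P = G"
proof -
  have GP: "G ** P = G"
    using arg_cong[OF nested, of conj_transpose] P G by (simp add: conj_transpose_mult)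
  have diff_mult: "(A - B) ** C = A ** C - B ** C"
    and mult_diff: "C ** (A - B) = C ** A - C ** B" for A B C :: "complex^'m^'m"
    by (simp_all add: vec_eq_iff matrix_matrix_mult_def algebra_simps sum_subtractf)
  have "(P - G) ** (P - G) = P - G"
    using P G nested GP by (simp add: diff_mult mult_diff)
  moreover have "conj_transpose (P - G) = P - G"
    using P G by (simp add: vec_eq_iff)
  ultimately have "trace (conj_transpose (P - G) ** (P - G)) = 0"
    using tr by (simp add: trace_sub)
  then show ?thesis
    using trace_conj_transpose_mult_eq_0 by fastforce
qed

lemma range_space_fixed:
  assumes "range_space A \<subseteq> range_space B" "K ** B = B"
  shows "K ** A = A"
proof -
  have "(K ** A) *v x = A *v x" for x
  proof -
    obtain y where "A *v x = B *v y"
      using assms(1) by (auto simp: range_space_def)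
    then show ?thesis
      using assms(2) by (metis matrix_vector_mul_assoc)
  qed
  then show ?thesis
    by (simp add: matrix_eq)
qed

lemma range_space_mult_subset: "range_space (B ** C) \<subseteq> range_space B"
  by (auto simp: range_space_def simp flip: matrix_vector_mul_assoc)

lemma partial_isometry_conj_transpose:
  assumes "partial_isometry T"
  shows "conj_transpose T ** T ** conj_transpose T = conj_transpose T"
  using arg_cong[OF assms[unfolded partial_isometry_def], of conj_transpose]
  by (simp add: conj_transpose_mult matrix_mul_assoc)

text \<open>
  The bridge between both sides of the characterization: \<open>T\<close> transports the projection onto the
  range of \<open>A\<^sup>*\<close> to a projection of the same trace, so it is enough that the latter lies below the
  projection onto the range of \<open>A\<close>.
\<close>

lemma moore_penrose_projection_transport:
  fixes T A :: "complex^'n^'m"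
  assumes X: "is_moore_penrose_inverse A X"
    and AT: "A = A ** conj_transpose T ** T"
    and nested: "A ** X ** (T ** (X ** A) ** conj_transpose T) = T ** (X ** A) ** conj_transpose T"
  shows "A ** X = T ** (X ** A) ** conj_transpose T"
proof (rule projection_eq_if_trace_eq)
  note x = X[unfolded is_moore_penrose_inverse_def]
  let ?Q = "X ** A"
  have QT: "?Q ** conj_transpose T ** T = ?Q"
    using AT by (metis matrix_mul_assoc)
  have QQ: "?Q ** ?Q = ?Q"
    using x by (metis matrix_mul_assoc)
  show "A ** X ** (A ** X) = A ** X"
    using x by (metis matrix_mul_assoc)
  show "conj_transpose (A ** X) = A ** X"
    using x by blast
  have "T ** ?Q ** conj_transpose T ** (T ** ?Q ** conj_transpose T)
      = T ** (?Q ** conj_transpose T ** T) ** ?Q ** conj_transpose T"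
    by (simp only: matrix_mul_assoc)
  also have "\<dots> = T ** (?Q ** ?Q) ** conj_transpose T"
    unfolding QT by (simp only: matrix_mul_assoc)
  finally show "T ** ?Q ** conj_transpose T ** (T ** ?Q ** conj_transpose T)
      = T ** ?Q ** conj_transpose T"
    unfolding QQ .
  have "conj_transpose ?Q = ?Q"
    using x by blast
  then show "conj_transpose (T ** ?Q ** conj_transpose T) = T ** ?Q ** conj_transpose T"
    by (metis conj_transpose_mult conj_transpose_involution matrix_mul_assoc)
  show "A ** X ** (T ** ?Q ** conj_transpose T) = T ** ?Q ** conj_transpose T"
    by (fact nested)
  have "trace (T ** ?Q ** conj_transpose T) = trace (?Q ** conj_transpose T ** T)"
    using trace_mult_commute[of T "?Q ** conj_transpose T"] by (simp only: matrix_mul_assoc)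
  also have "\<dots> = trace (A ** X)"
    unfolding QT by (rule trace_mult_commute)
  finally show "trace (A ** X) = trace (T ** ?Q ** conj_transpose T)" ..
qed

theorem theorem3p7:
  fixes T A :: "complex^'n^'m"
  assumes "partial_isometry T"
  shows "T_EP T A \<longleftrightarrow>
    T ** moore_penrose_inverse A ** A = A ** moore_penrose_inverse A ** T \<and>
    A = A ** conj_transpose T ** T"
proof (cases "A = A ** conj_transpose T ** T")
  case False
  then show ?thesis
    by (simp add: T_EP_def)
next
  case AT: True
  define X where "X = moore_penrose_inverse A"
  have X: "is_moore_penrose_inverse A X"
    unfolding X_def by (rule moore_penrose_inverse)
  note x = X[unfolded is_moore_penrose_inverse_def]
  let ?S = "conj_transpose T" and ?B = "conj_transpose A" and ?Y = "conj_transpose X"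
  have T: "T ** ?S ** T = T" and S: "?S ** T ** ?S = ?S"
    using assms partial_isometry_conj_transpose[OF assms] by (simp_all add: partial_isometry_def)
  have Q: "X ** A = ?B ** ?Y"
    using x by (metis conj_transpose_mult)
  have QB: "X ** A ** ?B = ?B"
    using x by (metis conj_transpose_mult matrix_mul_assoc)
  have BP: "?B ** (A ** X) = ?B"
    using x by (metis conj_transpose_mult)
  have QT: "X ** A ** ?S ** T = X ** A"
    using AT by (metis matrix_mul_assoc)
  have "range_space A = range_space (T ** ?B ** T) \<longleftrightarrow> T ** X ** A = A ** X ** T"
  proof
    assume R: "range_space A = range_space (T ** ?B ** T)"
    have "T ** ?S ** A = A"
      by (rule range_space_fixed[of A "T ** ?B ** T"]) (use R T in \<open>simp_all add: matrix_mul_assoc\<close>)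
    then have BT: "?B ** T ** ?S = ?B"
      by (metis conj_transpose_mult conj_transpose_involution matrix_mul_assoc)
    have "A ** X ** (T ** ?B ** T) = T ** ?B ** T"
      by (rule range_space_fixed[of "T ** ?B ** T" A]) (use R x in simp_all)
    then have "A ** X ** T ** (?B ** T ** ?S) = T ** (?B ** T ** ?S)"
      by (metis matrix_mul_assoc)
    then have "A ** X ** T ** ?B = T ** ?B"
      unfolding BT .
    then have "A ** X ** (T ** (X ** A) ** ?S) = T ** (X ** A) ** ?S"
      unfolding Q by (metis matrix_mul_assoc)
    then have "A ** X = T ** (X ** A) ** ?S"
      by (rule moore_penrose_projection_transport[OF X AT])
    then have "A ** X ** T = T ** (X ** A ** ?S ** T)"
      by (metis matrix_mul_assoc)
    then show "T ** X ** A = A ** X ** T"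
      unfolding QT by (simp only: matrix_mul_assoc)
  next
    assume C: "T ** X ** A = A ** X ** T"
    have "A ** X ** (T ** (X ** A) ** ?S) = T ** (X ** A) ** ?S"
      using C x by (metis matrix_mul_assoc)
    then have P: "A ** X = T ** (X ** A) ** ?S"
      by (rule moore_penrose_projection_transport[OF X AT])
    \<comment> \<open>The range of \<open>A\<close> is contained in that of \<open>T\<close>; in adjoint form, \<open>T T\<^sup>*\<close> is absorbed by \<open>A\<^sup>*\<close>.\<close>
    have "A ** X ** T ** ?S = A ** X"
      using P S by (metis matrix_mul_assoc)
    then have BT: "?B ** T ** ?S = ?B"
      using BP by (metis matrix_mul_assoc)
    have "T ** ?B ** T = A ** (X ** T ** ?B ** T)"
      using C QB by (metis matrix_mul_assoc)
    then have "range_space (T ** ?B ** T) \<subseteq> range_space A"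
      by (metis range_space_mult_subset)
    moreover
    have "A = T ** ?B ** ?Y ** ?S ** A"
      using P Q x by (metis matrix_mul_assoc)
    \<comment> \<open>Inserting \<open>T T\<^sup>*\<close> after \<open>A\<^sup>*\<close> exhibits \<open>A\<close> as a right multiple of \<open>T A\<^sup>* T\<close>.\<close>
    then have "A = T ** ?B ** T ** (?S ** ?Y ** ?S ** A)"
      using BT by (metis matrix_mul_assoc)
    then have "range_space A \<subseteq> range_space (T ** ?B ** T)"
      by (metis range_space_mult_subset)
    ultimately show "range_space A = range_space (T ** ?B ** T)"
      by blast
  qed
  then show ?thesis
    using AT by (simp add: T_EP_def X_def)
qed

end
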